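(* Let $X$ be a Banach space, let $f:X\to\mathbb{R}$ be quasiconvex, and let $m:=\mathcal{T}\operatorname{ess\,inf}_X f$. (i) If $x\in F_m$, then $f$ is not Gâteaux differentiable at $x$. (ii) If $x\in f^{-1}(m)$ and $f$ is Gâteaux differentiable at $x$, then the Gâteaux derivative $Df(x)$ is $0$.
   Context: Banach spaces are real. A function $f:X\to\mathbb{R}$ is quasiconvex if $f(\lambda x+(1-\lambda)y)\le\max\{f(x),f(y)\}$ for all $x,y\in X$ and $\lambda\in[0,1]$. For $\alpha\in\mathbb{R}\cup\{-\infty\}$, $F_\alpha:=\{x\in X:f(x)<\alpha\}$ (empty for $\alpha=-\infty$). First category means a countable union of nowhere dense subsets of $X$; second category means not of first category. The topological essential infimum is $\mathcal{T}\operatorname{ess\,inf}_X f:=\sup\{\alpha\in\mathbb{R}:F_\alpha\text{ is of first category}\}=\inf\{\alpha\in\mathbb{R}:F_\alpha\text{ is of second category}\}\in[-\infty,\infty)$. $f$ is Gâteaux differentiable at $x$ with derivative $Df(x)\in X^*$ if $Df(x)h=\lim_{t\to0}\frac{f(x+th)-f(x)}{t}$ for every $h\in X$. *)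

theory Defs
  imports "HOL-Analysis.Analysis"
begin

definition quasiconvex :: "('a::real_vector \<Rightarrow> real) \<Rightarrow> bool" where
  "quasiconvex f \<longleftrightarrow>
     (\<forall>x y. \<forall>l\<in>{0..1}. f (l *\<^sub>R x + (1 - l) *\<^sub>R y) \<le> max (f x) (f y))"

definition nowhere_dense :: "'a::topological_space set \<Rightarrow> bool" where
  "nowhere_dense S \<longleftrightarrow> interior (closure S) = {}"

definition first_category :: "'a::topological_space set \<Rightarrow> bool" where
  "first_category S \<longleftrightarrow>
     (\<exists>N :: nat \<Rightarrow> 'a set. (\<forall>n. nowhere_dense (N n)) \<and> S = (\<Union>n. N n))"

abbreviation second_category :: "'a::topological_space set \<Rightarrow> bool" where
  "second_category S \<equiv> \<not> first_category S"

text \<open>The level ranges over the extended reals because the topological essential infimum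
  may be \<open>- \<infinity>\<close>.\<close>

definition strict_sublevel :: "('a \<Rightarrow> real) \<Rightarrow> ereal \<Rightarrow> 'a set" where
  "strict_sublevel f a = {x. ereal (f x) < a}"

definition top_ess_inf :: "('a::topological_space \<Rightarrow> real) \<Rightarrow> ereal" where
  "top_ess_inf f = Sup (ereal ` {a :: real. first_category (strict_sublevel f (ereal a))})"

text \<open>The derivative is a \<open>blinfun\<close>, that is, an element of the topological dual.\<close>

definition has_gateaux_derivative ::
  "('a::real_normed_vector \<Rightarrow> real) \<Rightarrow> ('a \<Rightarrow>\<^sub>L real) \<Rightarrow> 'a \<Rightarrow> bool" where
  "has_gateaux_derivative f D x \<longleftrightarrow>
     (\<forall>h. ((\<lambda>t::real. (f (x + t *\<^sub>R h) - f x) / t) \<longlongrightarrow> blinfun_apply D h) (at 0))"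

definition gateaux_differentiable ::
  "('a::real_normed_vector \<Rightarrow> real) \<Rightarrow> 'a \<Rightarrow> bool" where
  "gateaux_differentiable f x \<longleftrightarrow> (\<exists>D. has_gateaux_derivative f D x)"

definition gateaux_derivative ::
  "('a::real_normed_vector \<Rightarrow> real) \<Rightarrow> 'a \<Rightarrow> ('a \<Rightarrow>\<^sub>L real)" where
  "gateaux_derivative f x = (THE D. has_gateaux_derivative f D x)"

lemma has_gateaux_derivative_unique:
  assumes "has_gateaux_derivative f D x" "has_gateaux_derivative f E x"
  shows "D = E"
proof (rule blinfun_eqI)
  fix h
  show "blinfun_apply D h = blinfun_apply E h"
    using assms tendsto_unique[OF trivial_limit_at[of "0::real"]]
    unfolding has_gateaux_derivative_def by blast
qed

lemma gateaux_derivative_eqI: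
  "has_gateaux_derivative f D x \<Longrightarrow> gateaux_derivative f x = D"
  unfolding gateaux_derivative_def by (blast intro: has_gateaux_derivative_unique)

lemma first_category_subset:
  assumes "first_category S" "T \<subseteq> S"
  shows "first_category T"
proof -
  obtain N where N: "\<And>n. nowhere_dense (N n)" "S = (\<Union>n::nat. N n)"
    using assms(1) unfolding first_category_def by blast
  have "nowhere_dense (N n \<inter> T)" for n
  proof -
    have "interior (closure (N n \<inter> T)) \<subseteq> interior (closure (N n))"
      by (intro interior_mono closure_mono) auto
    then show ?thesis
      using N(1)[of n] unfolding nowhere_dense_def by blast
  qed
  moreover have "T = (\<Union>n. N n \<inter> T)"
    using N(2) assms(2) by blast
  ultimately show ?thesis
    unfolding first_category_def by (intro exI[of _ "\<lambda>n. N n \<inter> T"]) blast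
qed

lemma top_ess_inf_eq_Inf:
  "top_ess_inf f = Inf (ereal ` {a :: real. second_category (strict_sublevel f (ereal a))})"
proof -
  let ?P = "\<lambda>a::real. first_category (strict_sublevel f (ereal a))"
  have down: "?P a" if "?P b" "a \<le> b" for a b
    using that(2) by (intro first_category_subset[OF that(1)])
      (auto simp: strict_sublevel_def)
  show ?thesis
    unfolding top_ess_inf_def
  proof (rule antisym)
    show "Sup (ereal ` {a. ?P a}) \<le> Inf (ereal ` {a. \<not> ?P a})"
      by (rule Sup_least, rule Inf_greatest) (auto, meson down nle_le)
    show "Inf (ereal ` {a. \<not> ?P a}) \<le> Sup (ereal ` {a. ?P a})"
    proof (rule ccontr)
      assume "\<not> ?thesis"
      then obtain r where r: "Sup (ereal ` {a. ?P a}) < ereal r"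
        "ereal r < Inf (ereal ` {a. \<not> ?P a})"
        using ereal_dense2 by (metis linorder_not_le)
      show False
      proof (cases "?P r")
        case True
        then have "ereal r \<le> Sup (ereal ` {a. ?P a})" by (intro Sup_upper) auto
        with r(1) show False by simp
      next
        case False
        then have "Inf (ereal ` {a. \<not> ?P a}) \<le> ereal r" by (intro Inf_lower) auto
        with r(2) show False by simp
      qed
    qed
  qed
qed

end

theory Submission
  imports Defs
begin

text \<open>
  Write \<open>F\<close> for the set of points where \<open>f < m\<close>. The supremum in the definition of \<open>m\<close> can be
  reached through rational levels, so \<open>F\<close> is itself of first category
  (\<open>first_category_below_top_ess_inf\<close>). The theorem then comes from asking how large \<open>F\<close> looks when
  seen from \<open>x\<close>. Suppose that for every direction \<open>h\<close> in a nonempty open set \<open>U\<close> the points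
  \<open>x + t h\<close> lie in \<open>F\<close> for all small \<open>t > 0\<close>. Each such \<open>h\<close> satisfies \<open>x + h / n \<in> F\<close> for some \<open>n\<close>,
  so \<open>U\<close> is covered by the countably many affine copies \<open>n (F - x)\<close> of \<open>F\<close>; these are of first
  category, contradicting Baire's theorem (\<open>second_category_of_initial_segments\<close>).

  Gateaux differentiability at \<open>x\<close> produces such a set \<open>U\<close> in both parts. If \<open>f x < m\<close>, then
  differentiability makes \<open>f\<close> continuous at \<open>x\<close> along every line, and \<open>U\<close> is the whole space. If
  \<open>f x = m\<close> and the derivative \<open>D\<close> is not zero, then \<open>U\<close> is the open half-space \<open>D h < 0\<close> of
  directions in which \<open>f\<close> decreases.
\<close>

lemma first_category_UN:
  fixes S :: "'i::countable \<Rightarrow> 'a::topological_space set"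
  assumes "\<And>i. first_category (S i)"
  shows "first_category (\<Union>i. S i)"
proof -
  obtain N where N: "\<And>i n. nowhere_dense (N i n)" "\<And>i. S i = (\<Union>n::nat. N i n)"
    using assms unfolding first_category_def by metis
  define M where "M k = (case from_nat k of (i, n) \<Rightarrow> N i n)" for k
  have "nowhere_dense (M k)" for k
    by (simp add: M_def N(1) split: prod.split)
  moreover have "(\<Union>i. S i) = (\<Union>k. M k)"
  proof
    show "(\<Union>i. S i) \<subseteq> (\<Union>k. M k)"
    proof
      fix y assume "y \<in> (\<Union>i. S i)"
      then obtain i n where "y \<in> N i n" using N(2) by blast
      then have "y \<in> M (to_nat (i, n))" by (simp add: M_def)
      then show "y \<in> (\<Union>k. M k)" by blast
    qed
    show "(\<Union>k. M k) \<subseteq> (\<Union>i. S i)"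
      using N(2) by (auto simp: M_def split: prod.splits)
  qed
  ultimately show ?thesis
    unfolding first_category_def by blast
qed

lemma nowhere_dense_vimage:
  assumes "nowhere_dense N" and cont: "continuous_on UNIV g"
    and open_map: "\<And>U. open U \<Longrightarrow> open (g ` U)"
  shows "nowhere_dense (g -` N)"
proof -
  have "closure (g -` N) \<subseteq> g -` closure N"
    using cont closure_subset
    by (intro closure_minimal closed_vimage) auto
  then have "g ` interior (closure (g -` N)) \<subseteq> interior (closure N)"
    using interior_subset by (intro interior_maximal open_map) blast+
  then show ?thesis
    using assms(1) by (simp add: nowhere_dense_def)
qed

lemma first_category_vimage:
  assumes "first_category S" "continuous_on UNIV g" "\<And>U. open U \<Longrightarrow> open (g ` U)"
  shows "first_category (g -` S)"
proof -
  obtain N where N: "\<And>n. nowhere_dense (N n)" "S = (\<Union>n::nat. N n)"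
    using assms(1) unfolding first_category_def by blast
  have "\<forall>n. nowhere_dense (g -` N n)"
    using nowhere_dense_vimage[OF N(1) assms(2,3)] by blast
  moreover have "g -` S = (\<Union>n. g -` N n)"
    using N(2) by blast
  ultimately show ?thesis
    unfolding first_category_def by (intro exI[of _ "\<lambda>n. g -` N n"]) blast
qed

lemma second_category_open:
  fixes U :: "'a::complete_space set"
  assumes "open U" "U \<noteq> {}"
  shows "second_category U"
proof
  assume "first_category U"
  then obtain N where N: "\<And>n. nowhere_dense (N n)" "U = (\<Union>n::nat. N n)"
    unfolding first_category_def by blast
  have "euclidean interior_of \<Union> (range (\<lambda>n. closure (N n))) = {}"
    using N(1) by (intro Baire_category_alt)
      (auto simp: nowhere_dense_def completely_metrizable_space_euclidean)
  then have "interior (\<Union>n. closure (N n)) = {}"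
    by simp
  moreover have "U \<subseteq> interior (\<Union>n. closure (N n))"
    using N(2) closure_subset by (intro interior_maximal assms(1)) blast
  ultimately show False
    using assms(2) by blast
qed

text \<open>The dilates \<open>n (S - x)\<close> with integral \<open>n > 0\<close> cover \<open>U\<close>. Since affine homeomorphisms preserve
  first category, \<open>S\<close> of first category would make \<open>U\<close> of first category, against Baire's theorem.\<close>

lemma second_category_of_initial_segments:
  fixes S U :: "'a::banach set"
  assumes "open U" "U \<noteq> {}"
    and segment: "\<And>h. h \<in> U \<Longrightarrow> eventually (\<lambda>t::real. x + t *\<^sub>R h \<in> S) (at_right 0)"
  shows "second_category S"
proof
  assume S: "first_category S"
  define g where "g n h = x + inverse (real (Suc n)) *\<^sub>R h" for n h
  have "first_category (g n -` S)" for n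
  proof (rule first_category_vimage[OF S])
    show "continuous_on UNIV (g n)"
      unfolding g_def by (intro continuous_intros)
    show "open (g n ` V)" if "open V" for V
      unfolding g_def using open_affinity[OF that, of "inverse (real (Suc n))" x] by simp
  qed
  then have "first_category (\<Union>n. g n -` S)"
    by (rule first_category_UN)
  moreover have "U \<subseteq> (\<Union>n. g n -` S)"
  proof
    fix h assume "h \<in> U"
    have "filterlim (\<lambda>n. inverse (real (Suc n))) (at_right 0) sequentially"
      by (intro tendsto_imp_filterlim_at_right LIMSEQ_inverse_real_of_nat) simp
    then have "eventually (\<lambda>n. g n h \<in> S) sequentially"
      unfolding g_def using segment[OF \<open>h \<in> U\<close>] by (rule eventually_compose_filterlim[rotated])
    then obtain n where "g n h \<in> S"
      by (meson eventually_happens sequentially_bot)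
    then show "h \<in> (\<Union>n. g n -` S)"
      by blast
  qed
  ultimately have "first_category U"
    by (rule first_category_subset)
  then show False
    using second_category_open[OF assms(1,2)] by contradiction
qed

text \<open>Between a value below the essential infimum and the essential infimum itself there is a
  rational level, so the set is a union of countably many sublevel sets of first category.\<close>

lemma first_category_below_top_ess_inf:
  "first_category (strict_sublevel f (top_ess_inf f))"
proof -
  define L where "L q = (if ereal (of_rat q) < top_ess_inf f
    then strict_sublevel f (ereal (of_rat q)) else {})" for q
  have "first_category (L q)" for q
  proof (cases "ereal (of_rat q) < top_ess_inf f")
    case True
    then obtain a where "ereal (of_rat q) < ereal a" "first_category (strict_sublevel f (ereal a))"
      unfolding top_ess_inf_def less_Sup_iff by blast
    then show ?thesis
      using True unfolding L_def
      by (auto intro: first_category_subset simp: strict_sublevel_def)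
  next
    case False
    then show ?thesis
      by (auto simp: L_def first_category_def nowhere_dense_def intro!: exI[of _ "\<lambda>_. {}"])
  qed
  then have "first_category (\<Union>q. L q)"
    by (rule first_category_UN)
  moreover have "strict_sublevel f (top_ess_inf f) \<subseteq> (\<Union>q. L q)"
  proof
    fix x assume "x \<in> strict_sublevel f (top_ess_inf f)"
    then obtain r where r: "ereal (f x) < ereal r" "ereal r < top_ess_inf f"
      using ereal_dense2 unfolding strict_sublevel_def by blast
    then obtain q where q: "f x < of_rat q" "of_rat q < r"
      using of_rat_dense by auto
    then have "ereal (of_rat q) < top_ess_inf f"
      using r(2) by (meson less_ereal.simps(1) less_trans)
    then have "x \<in> L q"
      using q(1) by (simp add: L_def strict_sublevel_def)
    then show "x \<in> (\<Union>q. L q)"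
      by blast
  qed
  ultimately show ?thesis
    by (rule first_category_subset)
qed

lemma gateaux_radially_continuous:
  assumes "has_gateaux_derivative f D x"
  shows "((\<lambda>t::real. f (x + t *\<^sub>R h)) \<longlongrightarrow> f x) (at 0)"
proof -
  have "((\<lambda>t. f x + t * ((f (x + t *\<^sub>R h) - f x) / t)) \<longlongrightarrow> f x + 0 * D h) (at 0)"
    using assms unfolding has_gateaux_derivative_def by (intro tendsto_intros) blast
  moreover have "eventually (\<lambda>t. f x + t * ((f (x + t *\<^sub>R h) - f x) / t) = f (x + t *\<^sub>R h)) (at 0)"
    by (auto simp: eventually_at_filter)
  ultimately show ?thesis
    by (auto dest: Lim_transform_eventually)
qed

lemma gateaux_descent_direction:
  assumes "has_gateaux_derivative f D x" and "D h < 0"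
  shows "eventually (\<lambda>t::real. f (x + t *\<^sub>R h) < f x) (at_right 0)"
proof -
  have "((\<lambda>t. (f (x + t *\<^sub>R h) - f x) / t) \<longlongrightarrow> D h) (at_right 0)"
    using assms(1) unfolding has_gateaux_derivative_def
    by (meson filterlim_at_split)
  then have "eventually (\<lambda>t. (f (x + t *\<^sub>R h) - f x) / t < 0) (at_right 0)"
    using assms(2) by (rule order_tendstoD)
  moreover have "eventually (\<lambda>t::real. 0 < t) (at_right 0)"
    by (rule eventually_at_right_less)
  ultimately show ?thesis
    by eventually_elim (simp add: divide_less_0_iff)
qed

theorem theorem5p1:
  fixes f :: "'a::banach \<Rightarrow> real" and m :: ereal
  assumes "quasiconvex f"
    and "m = top_ess_inf f"
  shows "(\<forall>x \<in> strict_sublevel f m. \<not> gateaux_differentiable f x) \<and>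
         (\<forall>x. ereal (f x) = m \<longrightarrow> gateaux_differentiable f x \<longrightarrow> gateaux_derivative f x = 0)"
proof (intro conjI ballI allI impI notI)
  have small: "first_category (strict_sublevel f m)"
    unfolding assms(2) by (rule first_category_below_top_ess_inf)
  show False if x: "x \<in> strict_sublevel f m" and "gateaux_differentiable f x" for x
  proof -
    obtain D where D: "has_gateaux_derivative f D x"
      using \<open>gateaux_differentiable f x\<close> unfolding gateaux_differentiable_def by blast
    have "eventually (\<lambda>t::real. x + t *\<^sub>R h \<in> strict_sublevel f m) (at_right 0)" for h
    proof -
      have "((\<lambda>t. ereal (f (x + t *\<^sub>R h))) \<longlongrightarrow> ereal (f x)) (at_right 0)"
        using gateaux_radially_continuous[OF D, of h] by (auto simp: filterlim_at_split)
      moreover have "ereal (f x) < m"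
        using x by (simp add: strict_sublevel_def)
      ultimately show ?thesis
        unfolding strict_sublevel_def mem_Collect_eq by (rule order_tendstoD(2))
    qed
    then have "second_category (strict_sublevel f m)"
      by (intro second_category_of_initial_segments[of UNIV]) auto
    with small show False
      by contradiction
  qed
  show "gateaux_derivative f x = 0" if fx: "ereal (f x) = m" and "gateaux_differentiable f x" for x
  proof -
    obtain D where D: "has_gateaux_derivative f D x"
      using \<open>gateaux_differentiable f x\<close> unfolding gateaux_differentiable_def by blast
    have "D = 0"
    proof (rule ccontr)
      assume "D \<noteq> 0"
      then obtain h where "D h \<noteq> 0"
        by (metis blinfun_eqI zero_blinfun.rep_eq)
      then have "D h < 0 \<or> D (- h) < 0"
        by (auto simp: blinfun.minus_right)
      then have "{h. D h < 0} \<noteq> {}"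
        by blast
      moreover have "open {h. D h < 0}"
        by (intro open_Collect_less continuous_intros)
      moreover have "eventually (\<lambda>t::real. x + t *\<^sub>R h \<in> strict_sublevel f m) (at_right 0)"
        if "h \<in> {h. D h < 0}" for h
        using gateaux_descent_direction[OF D, of h] that fx
        by (auto simp: strict_sublevel_def simp flip: fx)
      ultimately have "second_category (strict_sublevel f m)"
        by (intro second_category_of_initial_segments[of "{h. D h < 0}"])
      with small show False
        by contradiction
    qed
    then show ?thesis
      using gateaux_derivative_eqI[OF D] by simp
  qed
qed

end
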